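(* Let $G$ be a totally disconnected locally compact group and let $\alpha\in\mathrm{End}(G)$. Then there exists a compact open subgroup $V\le G$ which is tidy for $\alpha$.
   Context: $\mathrm{End}(G)$ is the semigroup of continuous homomorphisms $G\to G$. For a compact open subgroup $V\le G$ set $V_0:=V$, $V_{n+1}:=V\cap\alpha(V_n)$ and $V_{-n}:=\bigcap_{k=0}^n\alpha^{-k}(V)$ for $n\in\mathbb{N}_0$ (with $\alpha^{-k}$ denoting preimage under $\alpha^k$); $V_+:=\bigcap_{n\in\mathbb{N}_0}V_n$, $V_-:=\bigcap_{n\in\mathbb{N}_0}V_{-n}$, $V_{--}:=\bigcup_{n\in\mathbb{N}_0}\alpha^{-n}(V_-)$. $V$ is tidy above for $\alpha$ if $V=V_+V_-$, tidy below for $\alpha$ if $V_{--}$ is closed in $G$, and tidy for $\alpha$ if it is both tidy above and tidy below. *)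

theory Defs
  imports "HOL-Analysis.Analysis" "HOL-Algebra.Coset"
begin

definition totally_disconnected_space :: "'a topology \<Rightarrow> bool" where
  "totally_disconnected_space T \<longleftrightarrow>
     (\<forall>x\<in>topspace T. connected_component_of_set T x = {x})"

locale topological_group = group G
  for G (structure) and T :: "'a topology" +
  assumes topspace_eq_carrier: "topspace T = carrier G"
    and continuous_map_mult:
      "continuous_map (prod_topology T T) T (\<lambda>(x, y). x \<otimes>\<^bsub>G\<^esub> y)"
    and continuous_map_inv: "continuous_map T T (\<lambda>x. inv\<^bsub>G\<^esub> x)"

text \<open>The Hausdorff property is not a separate axiom: it follows from total
  disconnectedness, see \<open>Hausdorff\<close> below.\<close>

locale tdlc_group = topological_group G T
  for G (structure) and T :: "'a topology" +
  assumes locally_compact: "locally_compact_space T"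
    and totally_disconnected: "totally_disconnected_space T"

lemma (in tdlc_group) Hausdorff: "Hausdorff_space T"
proof -
  let ?q = "\<lambda>z. case z of (x, y) \<Rightarrow> x \<otimes> inv y"
  have one: "closedin T {\<one>}"
    using closedin_connected_component_of[of T \<one>] totally_disconnected
    by (simp add: totally_disconnected_space_def topspace_eq_carrier)
  have "continuous_map (prod_topology T T) (prod_topology T T) (\<lambda>z. (fst z, inv (snd z)))"
    by (intro continuous_map_pairedI continuous_map_fst
        continuous_map_compose[OF continuous_map_snd continuous_map_inv, unfolded o_def])
  from continuous_map_compose[OF this continuous_map_mult]
  have q: "continuous_map (prod_topology T T) T ?q"
    by (simp add: o_def case_prod_unfold)
  have "x \<otimes> inv y = \<one> \<longleftrightarrow> x = y" if "x \<in> carrier G" "y \<in> carrier G" for x y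
    using that by (metis inv_closed inv_inv inv_equality r_inv)
  then have "{z \<in> topspace (prod_topology T T). ?q z \<in> {\<one>}} = (\<lambda>x. (x, x)) ` topspace T"
    by (auto simp: topspace_eq_carrier)
  with closedin_continuous_map_preimage[OF q one]
  show ?thesis
    by (simp add: Hausdorff_space_closedin_diagonal)
qed

text \<open>An element of \<^term>\<open>hom G G\<close> is a total HOL function whose values outside
  \<^term>\<open>carrier G\<close> are arbitrary; all preimages below are therefore intersected
  with the carrier.\<close>

definition continuous_End :: "('a, 'b) monoid_scheme \<Rightarrow> 'a topology \<Rightarrow> ('a \<Rightarrow> 'a) set" where
  "continuous_End G T = {\<alpha> \<in> hom G G. continuous_map T T \<alpha>}"

definition iter_preimage ::
    "('a, 'b) monoid_scheme \<Rightarrow> ('a \<Rightarrow> 'a) \<Rightarrow> nat \<Rightarrow> 'a set \<Rightarrow> 'a set" where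
  "iter_preimage G \<alpha> k S = {x \<in> carrier G. (\<alpha> ^^ k) x \<in> S}"

text \<open>\<open>V_pos \<alpha> V n\<close> is $V_n$ and \<open>V_neg G \<alpha> V n\<close> is $V_{-n}$, for natural \<open>n\<close>.\<close>

primrec V_pos :: "('a \<Rightarrow> 'a) \<Rightarrow> 'a set \<Rightarrow> nat \<Rightarrow> 'a set" where
  "V_pos \<alpha> V 0 = V"
| "V_pos \<alpha> V (Suc n) = V \<inter> \<alpha> ` V_pos \<alpha> V n"

definition V_neg ::
    "('a, 'b) monoid_scheme \<Rightarrow> ('a \<Rightarrow> 'a) \<Rightarrow> 'a set \<Rightarrow> nat \<Rightarrow> 'a set" where
  "V_neg G \<alpha> V n = (\<Inter>k\<in>{0..n}. iter_preimage G \<alpha> k V)"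

definition V_plus :: "('a \<Rightarrow> 'a) \<Rightarrow> 'a set \<Rightarrow> 'a set" where
  "V_plus \<alpha> V = (\<Inter>n. V_pos \<alpha> V n)"

definition V_minus :: "('a, 'b) monoid_scheme \<Rightarrow> ('a \<Rightarrow> 'a) \<Rightarrow> 'a set \<Rightarrow> 'a set" where
  "V_minus G \<alpha> V = (\<Inter>n. V_neg G \<alpha> V n)"

definition V_minus_minus :: "('a, 'b) monoid_scheme \<Rightarrow> ('a \<Rightarrow> 'a) \<Rightarrow> 'a set \<Rightarrow> 'a set" where
  "V_minus_minus G \<alpha> V = (\<Union>n. iter_preimage G \<alpha> n (V_minus G \<alpha> V))"

definition compact_open_subgroup ::
    "'a set \<Rightarrow> ('a, 'b) monoid_scheme \<Rightarrow> 'a topology \<Rightarrow> bool" where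
  "compact_open_subgroup V G T \<longleftrightarrow> subgroup V G \<and> compactin T V \<and> openin T V"

definition tidy_above :: "('a, 'b) monoid_scheme \<Rightarrow> ('a \<Rightarrow> 'a) \<Rightarrow> 'a set \<Rightarrow> bool" where
  "tidy_above G \<alpha> V \<longleftrightarrow> V = V_plus \<alpha> V <#>\<^bsub>G\<^esub> V_minus G \<alpha> V"

definition tidy_below ::
    "('a, 'b) monoid_scheme \<Rightarrow> 'a topology \<Rightarrow> ('a \<Rightarrow> 'a) \<Rightarrow> 'a set \<Rightarrow> bool" where
  "tidy_below G T \<alpha> V \<longleftrightarrow> closedin T (V_minus_minus G \<alpha> V)"

definition tidy ::
    "('a, 'b) monoid_scheme \<Rightarrow> 'a topology \<Rightarrow> ('a \<Rightarrow> 'a) \<Rightarrow> 'a set \<Rightarrow> bool" where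
  "tidy G T \<alpha> V \<longleftrightarrow> tidy_above G \<alpha> V \<and> tidy_below G T \<alpha> V"

end

theory Submission
  imports Defs
begin

text \<open>
  The subgroup is found in three moves: make some compact open subgroup tidy above, enlarge it so
  that it swallows the obstruction to tidiness below, and make the result tidy above again.

  \<^emph>\<open>Tidiness above.\<close> A compact open subgroup \<open>V\<close> exists by \<open>van_Dantzig\<close>. The compact groups
  \<open>V\<^sub>n\<close> decrease to \<open>V\<^sub>+\<close>, so \<open>\<alpha>(V\<^sub>N)\<close> lies in the open set \<open>\<alpha>(V\<^sub>+) V\<close> for some \<open>N\<close>. For an element of
  \<open>V\<close> whose orbit stays in \<open>V\<close> long enough, this allows the stay to be prolonged step by step by
  dividing by elements of \<open>V\<^sub>+\<close>; in the limit \<open>V\<^bsub>-N\<^esub>\<close> is tidy above (\<open>neg_tidy_above\<close>).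

  \<^emph>\<open>The obstruction to tidiness below.\<close> Call \<open>x\<close> homoclinic for \<open>V\<close> if it lies on a two-sided
  \<open>\<alpha>\<close>-trajectory which is in \<open>V\<close> at all but finitely many times. These elements form a group \<open>H(V)\<close>
  that grows with \<open>V\<close>. If \<open>V\<close> is tidy above and \<open>H(V) \<subseteq> V\<close>, then
  \<open>V\<^bsub>--\<^esub> \<inter> V = V\<^sub>-\<close>, so \<open>V\<^bsub>--\<^esub>\<close> is closed near the identity and hence closed
  (\<open>tidy_below_if_homoclinic_subset\<close>). So it is enough to have \<open>H(V) \<subseteq> V\<close>.

  \<^emph>\<open>Swallowing it.\<close> Up to elements of \<open>V\<^sub>+\<close>, an excursion from \<open>V\<close> can begin in only finitely many
  ways, so representatives of these return to \<open>V\<close> for good within a common time; therefore \<open>H(V)\<close> has compact closure \<open>K\<close>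
  (\<open>homoclinic_bounded\<close>), and \<open>\<alpha>(K) \<subseteq> K\<close>. Intersecting the conjugates of \<open>V\<close> by elements of \<open>K\<close> and
  multiplying by \<open>K\<close> gives a compact open subgroup \<open>W\<close> with \<open>K \<subseteq> W \<subseteq> V K\<close>. The decisive fact is
  that \<open>H(W) \<subseteq> K\<close> (\<open>homoclinic_subset_Hcl_if_subset\<close>): for \<open>V\<close> tidy above, an element of \<open>V\<^sub>+\<close> with
  bounded forward orbit belongs to \<open>V\<^sub>- K\<close> (\<open>bounded_orbit_decomposition\<close>), so the distant past of
  a trajectory that is homoclinic for \<open>W\<close> lies in \<open>V\<^sub>- K\<close>, and what \<open>\<alpha>\<close> leaves of \<open>V\<^sub>-\<close> after
  arbitrarily many steps is contained in \<open>K\<close>.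

  Finally \<open>W\<close> is replaced by a \<open>W\<^bsub>-n\<^esub>\<close> that is tidy above. It still contains the
  \<open>\<alpha>\<close>-invariant group \<open>K\<close>, which contains \<open>H(W)\<close> and with it \<open>H(W\<^bsub>-n\<^esub>)\<close>.
\<close>

section \<open>Topological groups\<close>

lemma (in group) mult_inv_cancel_left [simp]:
  "x \<in> carrier G \<Longrightarrow> y \<in> carrier G \<Longrightarrow> x \<otimes> (inv x \<otimes> y) = y"
  "x \<in> carrier G \<Longrightarrow> y \<in> carrier G \<Longrightarrow> inv x \<otimes> (x \<otimes> y) = y"
  by (simp_all add: m_assoc[symmetric])

context topological_group
begin

lemma continuous_map_group_mult:
  assumes "continuous_map X T f" "continuous_map X T g"
  shows "continuous_map X T (\<lambda>x. f x \<otimes> g x)"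
  using continuous_map_compose[OF continuous_map_pairedI[OF assms] continuous_map_mult]
  by (simp add: o_def)

lemma continuous_map_group_inv:
  assumes "continuous_map X T f"
  shows "continuous_map X T (\<lambda>x. inv f x)"
  using continuous_map_compose[OF assms continuous_map_inv] by (simp add: o_def)

lemma continuous_map_l_mult:
  assumes "a \<in> carrier G" shows "continuous_map T T (\<lambda>x. a \<otimes> x)"
  using assms by (intro continuous_map_group_mult) (auto simp: topspace_eq_carrier)

lemma openin_carrier: "openin T U \<Longrightarrow> U \<subseteq> carrier G"
  using openin_subset topspace_eq_carrier by blast

lemma compactin_carrier: "compactin T U \<Longrightarrow> U \<subseteq> carrier G"
  using compactin_subset_topspace topspace_eq_carrier by blast

lemma openin_l_coset:
  assumes "openin T U" "a \<in> carrier G" shows "openin T (a <# U)"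
proof -
  have "a <# U = {x \<in> topspace T. inv a \<otimes> x \<in> U}"
    using assms openin_carrier[OF assms(1)]
    by (auto simp: l_coset_def topspace_eq_carrier subset_eq inv_solve_left' m_assoc[symmetric])
  then show ?thesis
    using openin_continuous_map_preimage[OF continuous_map_l_mult assms(1), of "inv a"] assms(2)
    by simp
qed

lemma openin_set_mult:
  assumes "A \<subseteq> carrier G" "openin T U" shows "openin T (A <#> U)"
proof -
  have "A <#> U = (\<Union>a\<in>A. a <# U)" by (auto simp: set_mult_def l_coset_def)
  with assms show ?thesis by (auto intro!: openin_l_coset)
qed

lemma compactin_set_mult:
  assumes "compactin T A" "compactin T B" shows "compactin T (A <#> B)"
proof -
  have "A <#> B = (\<lambda>(x, y). x \<otimes> y) ` (A \<times> B)" by (auto simp: set_mult_def)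
  then show ?thesis
    using image_compactin[OF _ continuous_map_mult, of "A \<times> B"] assms by (simp add: compactin_Times)
qed

text \<open>The finiteness behind every counting argument below.\<close>
lemma finite_coset_cover:
  assumes "compactin T C" "subgroup V G" "openin T V"
  obtains F where "finite F" "F \<subseteq> C" "C \<subseteq> F <#> V"
proof -
  have C: "C \<subseteq> carrier G" using assms compactin_carrier by blast
  have "\<exists>\<F>. finite \<F> \<and> \<F> \<subseteq> (\<lambda>a. a <# V) ` C \<and> C \<subseteq> \<Union>\<F>"
  proof (rule compactinD[OF assms(1)])
    show "openin T U" if "U \<in> (\<lambda>a. a <# V) ` C" for U
      using that C assms by (auto intro: openin_l_coset)
    show "C \<subseteq> \<Union> ((\<lambda>a. a <# V) ` C)"
      using C subgroup.one_closed[OF assms(2)] by (force simp: l_coset_def)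
  qed
  then obtain F where "finite F" "F \<subseteq> C" "C \<subseteq> (\<Union>a\<in>F. a <# V)"
    by (metis finite_subset_image)
  moreover have "(\<Union>a\<in>F. a <# V) = F <#> V" by (auto simp: set_mult_def l_coset_def)
  ultimately show ?thesis using that by metis
qed

lemma open_subgroup_closed:
  assumes "subgroup V G" "openin T V" shows "closedin T V"
proof -
  interpret V: subgroup V G by fact
  have "(carrier G - V) <#> V = carrier G - V"
  proof (intro equalityI subsetI)
    fix x assume "x \<in> (carrier G - V) <#> V"
    then obtain a v where x: "x = a \<otimes> v" "a \<in> carrier G" "a \<notin> V" "v \<in> V"
      by (auto simp: set_mult_def)
    then have "a = x \<otimes> inv v" by (simp add: m_assoc V.mem_carrier)
    with x show "x \<in> carrier G - V" by (metis DiffI V.m_closed V.m_inv_closed V.mem_carrier m_closed)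
  next
    fix x assume "x \<in> carrier G - V"
    then have "x = x \<otimes> \<one>" "x \<in> carrier G - V" by auto
    then show "x \<in> (carrier G - V) <#> V" using V.one_closed unfolding set_mult_def by blast
  qed
  moreover have "openin T ((carrier G - V) <#> V)"
    using assms by (intro openin_set_mult) auto
  ultimately show ?thesis
    using V.subset by (simp add: closedin_def topspace_eq_carrier)
qed

lemma subgroup_open_if_contains_open:
  assumes "subgroup H G" "openin T U" "\<one> \<in> U" "U \<subseteq> H" shows "openin T H"
proof -
  interpret H: subgroup H G by fact
  have "H <#> U = H"
    using assms(3,4) by (force simp: set_mult_def)
  then show ?thesis using openin_set_mult[OF H.subset assms(2)] by simp
qed

text \<open>The infix for topological closure is also the syntax of the closure operator of
  setoids, which applies to \<open>G\<close>; hence this name.\<close>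
abbreviation cl :: "'a set \<Rightarrow> 'a set" where
  "cl S \<equiv> Abstract_Topology.closure_of T S"

lemma closure_of_subgroup:
  assumes "subgroup H G" shows "subgroup (cl H) G"
proof -
  interpret H: subgroup H G by fact
  let ?f = "\<lambda>z. fst z \<otimes> inv snd z"
  have sub: "H \<subseteq> cl H" by (simp add: H.subset closure_of_subset topspace_eq_carrier)
  have c: "cl H \<subseteq> carrier G" using closure_of_subset_topspace topspace_eq_carrier by metis
  have "continuous_map (prod_topology T T) T ?f"
    by (intro continuous_map_group_mult continuous_map_group_inv continuous_map_fst continuous_map_snd)
  from continuous_map_image_closure_subset[OF this, of "H \<times> H"]
  have "?f ` (cl H \<times> cl H) \<subseteq> cl (?f ` (H \<times> H))"
    by (simp add: closure_of_Times)
  also have "\<dots> \<subseteq> cl H" by (rule closure_of_mono) auto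
  finally have *: "x \<otimes> inv y \<in> cl H" if "x \<in> cl H" "y \<in> cl H" for x y
    using that by (auto simp: image_subset_iff)
  have one: "\<one> \<in> cl H" using sub by auto
  have inv: "inv y \<in> cl H" if "y \<in> cl H" for y
    using *[OF one that] that c by auto
  show ?thesis
  proof (rule subgroupI)
    show "x \<otimes> y \<in> cl H" if "x \<in> cl H" "y \<in> cl H" for x y
      using *[OF that(1) inv[OF that(2)]] that c by auto
  qed (use c one inv in auto)
qed

text \<open>A point of \<open>l W - L\<close> with \<open>l \<in> L\<close> has the neighbourhood \<open>l (W - L)\<close> off \<open>L\<close>, and a point \<open>x\<close>
  outside \<open>L W\<close> has its whole coset \<open>x W\<close> off \<open>L\<close>.\<close>
lemma subgroup_closed_if_locally_closed:
  assumes "subgroup L G" "subgroup W G" "openin T W" "closedin T (L \<inter> W)"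
  shows "closedin T L"
proof -
  interpret L: subgroup L G by fact
  interpret W: subgroup W G by fact
  have "openin T (carrier G - L)"
  proof (subst openin_subopen, intro ballI)
    fix x assume x: "x \<in> carrier G - L"
    show "\<exists>U. openin T U \<and> x \<in> U \<and> U \<subseteq> carrier G - L"
    proof (cases "(x <# W) \<inter> L = {}")
      case True
      moreover have "openin T (x <# W)"
        using x by (intro openin_l_coset assms) blast
      moreover have "x \<in> x <# W"
        using x W.one_closed unfolding l_coset_def by (intro UN_I[of \<one>]) auto
      ultimately show ?thesis using openin_carrier by (intro exI[of _ "x <# W"]) blast
    next
      case False
      then obtain w where w: "w \<in> W" "x \<otimes> w \<in> L" by (auto simp: l_coset_def)
      define l where "l = x \<otimes> w"
      have l: "l \<in> L" "l \<in> carrier G" using w x by (auto simp: l_def)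
      have eq: "x = l \<otimes> inv w" using w x by (simp add: l_def m_assoc)
      then have "inv w \<notin> L" using l x by auto
      then have "inv w \<in> W - L \<inter> W" using w by auto
      then have "x \<in> l <# (W - L \<inter> W)" unfolding eq l_coset_def by blast
      moreover have "openin T (l <# (W - L \<inter> W))"
        using l assms(3,4) by (intro openin_l_coset openin_diff)
      moreover have "l <# (W - L \<inter> W) \<subseteq> carrier G - L"
      proof
        fix y assume "y \<in> l <# (W - L \<inter> W)"
        then obtain u where u: "y = l \<otimes> u" "u \<in> W" "u \<notin> L" by (auto simp: l_coset_def)
        have uc: "u \<in> carrier G" using u(2) by (rule W.mem_carrier)
        then have "u = inv l \<otimes> y" using l u(1) by (simp add: m_assoc[symmetric])
        with u(3) have "y \<notin> L" using l by auto
        with uc u(1) l show "y \<in> carrier G - L" by simp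
      qed
      ultimately show ?thesis by blast
    qed
  qed
  then show ?thesis using L.subset by (simp add: closedin_def topspace_eq_carrier)
qed

end

section \<open>van Dantzig's theorem\<close>

context tdlc_group
begin

text \<open>The component \<open>{\<one>}\<close> is compact, and in a locally compact Hausdorff space a compact
  component can be separated by a clopen set from any closed set disjoint from it. Separating it
  from the complement of a neighbourhood inside a compact set makes the clopen set compact.\<close>
lemma ex_compact_open_nbhd_one:
  obtains U where "compactin T U" "openin T U" "\<one> \<in> U"
proof -
  obtain N C where NC: "openin T N" "compactin T C" "\<one> \<in> N" "N \<subseteq> C"
    using locally_compact unfolding locally_compact_space_def by (metis one_closed topspace_eq_carrier)
  have clC: "closedin T C" using NC Hausdorff compactin_imp_closedin by blast
  have "connected_component_of_set T \<one> = {\<one>}"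
    using totally_disconnected by (simp add: totally_disconnected_space_def topspace_eq_carrier)
  then have "{\<one>} \<in> connected_components_of T"
    unfolding connected_components_of_def
    by (intro image_eqI[of _ _ \<one>]) (simp_all add: topspace_eq_carrier)
  then have "separated_between T {\<one>} (topspace T - N)"
  proof (rule separated_between_compact_connected_component[OF locally_compact Hausdorff])
    show "compactin T {\<one>}" by (simp add: topspace_eq_carrier)
    show "closedin T (topspace T - N)" using NC by blast
    show "disjnt {\<one>} (topspace T - N)" using NC by (simp add: disjnt_iff)
  qed
  then obtain U U' where U: "openin T U" "openin T U'" "U \<union> U' = topspace T" "disjnt U U'"
    "\<one> \<in> U" "topspace T - N \<subseteq> U'"
    unfolding separated_between_def by auto
  then have "U \<subseteq> C" using NC openin_subset[of T U] unfolding disjnt_iff by blast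
  moreover have "U = topspace T - U'" using U by (auto simp: disjnt_iff)
  ultimately have "compactin T U" using U NC clC
    using closed_compactin[OF NC(2), of U] closedin_diff[OF closedin_topspace, of T U'] by simp
  with that U show thesis by blast
qed

text \<open>The right stabilizer of a compact open neighbourhood \<open>U\<close> of the identity is a subgroup
  contained in \<open>U\<close>. It is open because, by the tube lemma, all sufficiently small elements move
  \<open>U\<close> into itself.\<close>
theorem van_Dantzig:
  obtains V where "compact_open_subgroup V G T"
proof -
  obtain U where U: "compactin T U" "openin T U" "\<one> \<in> U"
    using ex_compact_open_nbhd_one .
  have Uc: "U \<subseteq> carrier G" using U compactin_carrier by blast
  define V where "V = {g \<in> carrier G. \<forall>u\<in>carrier G. u \<otimes> g \<in> U \<longleftrightarrow> u \<in> U}"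
  have V_iff: "g \<in> V \<longleftrightarrow> g \<in> carrier G \<and> (\<forall>u\<in>carrier G. u \<otimes> g \<in> U \<longleftrightarrow> u \<in> U)" for g
    by (simp add: V_def)
  have sub: "subgroup V G"
  proof (rule subgroupI)
    show "V \<noteq> {}" using V_iff[of \<one>] by auto
  next
    fix a assume a: "a \<in> V"
    have ac: "a \<in> carrier G" using a V_iff by blast
    have "u \<otimes> inv a \<in> U \<longleftrightarrow> u \<in> U" if u: "u \<in> carrier G" for u
    proof -
      have "u \<otimes> inv a \<otimes> a \<in> U \<longleftrightarrow> u \<otimes> inv a \<in> U" using a u ac V_iff by blast
      then show ?thesis using u ac by (simp add: m_assoc)
    qed
    then show "inv a \<in> V" using ac V_iff by blast
    fix b assume b: "b \<in> V"
    have bc: "b \<in> carrier G" using b V_iff by blast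
    have "u \<otimes> (a \<otimes> b) \<in> U \<longleftrightarrow> u \<in> U" if u: "u \<in> carrier G" for u
    proof -
      have "u \<otimes> a \<otimes> b \<in> U \<longleftrightarrow> u \<otimes> a \<in> U" "u \<otimes> a \<in> U \<longleftrightarrow> u \<in> U"
        using a b u ac V_iff by blast+
      then show ?thesis using u ac bc by (simp add: m_assoc)
    qed
    then show "a \<otimes> b \<in> V" using ac bc V_iff by blast
  qed (simp add: V_def subset_eq)
  have VU: "V \<subseteq> U"
  proof
    fix g assume "g \<in> V"
    then have "\<one> \<otimes> g \<in> U" "g \<in> carrier G" using U one_closed unfolding V_def by blast+
    then show "g \<in> U" by simp
  qed
  have "\<exists>P Q. openin T P \<and> openin T Q \<and> U \<subseteq> P \<and> \<one> \<in> Q \<and>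
          P \<times> Q \<subseteq> {z \<in> topspace (prod_topology T T). (case z of (x, y) \<Rightarrow> x \<otimes> y) \<in> U}"
  proof (rule tube_lemma_left[OF openin_continuous_map_preimage[OF continuous_map_mult U(2)] U(1)])
    show "\<one> \<in> topspace T" by (simp add: topspace_eq_carrier)
  qed (use U Uc in \<open>auto simp: topspace_eq_carrier\<close>)
  then obtain P Q where PQ: "openin T Q" "U \<subseteq> P" "\<one> \<in> Q"
    "P \<times> Q \<subseteq> {z \<in> topspace (prod_topology T T). (case z of (x, y) \<Rightarrow> x \<otimes> y) \<in> U}"
    by blast
  have Q: "openin T Q" "\<one> \<in> Q" using PQ by blast+
  have QU: "u \<otimes> g \<in> U" if "u \<in> U" "g \<in> Q" for u g
    using subsetD[OF PQ(4), of "(u, g)"] subsetD[OF PQ(2)] that by auto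
  define Q' where "Q' = {g \<in> topspace T. inv g \<in> Q} \<inter> Q"
  have Q': "openin T Q'" "\<one> \<in> Q'"
    unfolding Q'_def using Q openin_continuous_map_preimage[OF continuous_map_inv Q(1)]
    by (simp_all add: openin_Int topspace_eq_carrier)
  have "Q' \<subseteq> V"
  proof
    fix g assume "g \<in> Q'"
    then have g: "g \<in> carrier G" "g \<in> Q" "inv g \<in> Q" by (auto simp: Q'_def topspace_eq_carrier)
    have "u \<in> U" if "u \<otimes> g \<in> U" "u \<in> carrier G" for u
      using QU[OF that(1) g(3)] that g by (simp add: m_assoc)
    with g QU have "u \<otimes> g \<in> U \<longleftrightarrow> u \<in> U" if "u \<in> carrier G" for u using that by blast
    with g show "g \<in> V" using V_iff by blast
  qed
  with sub Q' have op: "openin T V" using subgroup_open_if_contains_open by blast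
  then have "compactin T V"
    using sub U VU closed_compactin open_subgroup_closed by blast
  with sub op that show thesis by (simp add: compact_open_subgroup_def)
qed

end

section \<open>Dynamics of an endomorphism\<close>

locale tdlc_endo = tdlc_group G T for G (structure) and T :: "'a topology" +
  fixes \<alpha> :: "'a \<Rightarrow> 'a"
  assumes endo: "\<alpha> \<in> continuous_End G T"
begin

abbreviation "cosub V \<equiv> compact_open_subgroup V G T"
abbreviation "Pos V n \<equiv> V_pos \<alpha> V n"
abbreviation "Neg V n \<equiv> V_neg G \<alpha> V n"
abbreviation "Plus V \<equiv> V_plus \<alpha> V"
abbreviation "Minus V \<equiv> V_minus G \<alpha> V"
abbreviation "MinusMinus V \<equiv> V_minus_minus G \<alpha> V"

lemma cosubD: assumes "cosub V"
  shows "subgroup V G" "compactin T V" "openin T V" "closedin T V" "V \<subseteq> carrier G"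
  using assms open_subgroup_closed[of V] subgroup.subset[of V G]
  by (auto simp: compact_open_subgroup_def)

lemma iter_endo: "(\<alpha> ^^ n) \<in> hom G G \<and> continuous_map T T (\<alpha> ^^ n)"
proof (induction n)
  case 0
  then show ?case by (simp add: hom_def)
next
  case (Suc n)
  have "\<alpha> \<in> hom G G" "continuous_map T T \<alpha>" using endo by (auto simp: continuous_End_def)
  with Suc show ?case
    using continuous_map_compose[of T T "\<alpha> ^^ n" T \<alpha>]
    by (auto simp: hom_def Pi_def o_def)
qed

lemma iter_continuous: "continuous_map T T (\<alpha> ^^ n)"
  using iter_endo by blast

lemma iter_hom: "group_hom G G (\<alpha> ^^ n)"
  using iter_endo is_group by (simp add: group_hom_def group_hom_axioms_def)

lemma iter_closed [simp, intro]: "x \<in> carrier G \<Longrightarrow> (\<alpha> ^^ n) x \<in> carrier G"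
  using iter_hom group_hom.hom_closed by metis

lemma iter_mult [simp]:
  "x \<in> carrier G \<Longrightarrow> y \<in> carrier G \<Longrightarrow> (\<alpha> ^^ n) (x \<otimes> y) = (\<alpha> ^^ n) x \<otimes> (\<alpha> ^^ n) y"
  using iter_hom group_hom.hom_mult by metis

lemma iter_inv [simp]: "x \<in> carrier G \<Longrightarrow> (\<alpha> ^^ n) (inv x) = inv (\<alpha> ^^ n) x"
  using iter_hom group_hom.hom_inv by metis

lemma iter_one [simp]: "(\<alpha> ^^ n) \<one> = \<one>"
  using iter_hom group_hom.hom_one by metis

lemma iter_subgroup: "subgroup H G \<Longrightarrow> subgroup ((\<alpha> ^^ n) ` H) G"
  using iter_hom group_hom.subgroup_img_is_subgroup by metis

lemma iter_add: "(\<alpha> ^^ m) ((\<alpha> ^^ n) x) = (\<alpha> ^^ (m + n)) x"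
  by (simp add: funpow_add)

lemma \<alpha>_closed [simp, intro]: "x \<in> carrier G \<Longrightarrow> \<alpha> x \<in> carrier G"
  using iter_closed[of x 1] by simp

text \<open>The passages to the limit below all go through this form of Cantor's intersection
  theorem, with a suitable closed test set \<open>P\<close>.\<close>
lemma nested_compact_meets:
  assumes comp: "\<And>n::nat. compactin T (A n)" and dec: "\<And>n. A (Suc n) \<subseteq> A n"
    and P: "closedin T P" and ne: "\<And>n. A n \<inter> P \<noteq> {}"
  shows "(\<Inter>n. A n) \<inter> P \<noteq> {}"
proof -
  let ?X = "subtopology T (A 0)"
  have mono: "decseq A" using dec by (simp add: decseq_Suc_iff)
  then have A0: "A n \<subseteq> A 0" for n by (simp add: decseqD)
  have "(\<Inter>n. A n \<inter> P) \<noteq> {}"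
  proof (rule compact_space_imp_nest[of ?X])
    show "compact_space ?X" using comp compact_space_subtopology by blast
    show "closedin ?X (A n \<inter> P)" for n
      using comp compactin_imp_closedin[OF Hausdorff] P A0[of n]
      by (intro closedin_subset_topspace) auto
    show "decseq (\<lambda>n. A n \<inter> P)" using mono unfolding decseq_def by blast
  qed (fact ne)
  then show ?thesis by auto
qed

lemma Inter_image_nested:
  assumes comp: "\<And>n::nat. compactin T (A n)" and dec: "\<And>n. A (Suc n) \<subseteq> A n"
  shows "(\<Inter>n. \<alpha> ` A n) \<subseteq> \<alpha> ` (\<Inter>n. A n)"
proof
  fix x assume x: "x \<in> (\<Inter>n. \<alpha> ` A n)"
  then have "x \<in> carrier G" using compactin_carrier[OF comp] by fastforce
  then have "closedin T {a \<in> topspace T. \<alpha> a \<in> {x}}"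
    using iter_continuous[of 1] Hausdorff
    by (intro closedin_continuous_map_preimage[of T T])
      (auto simp: topspace_eq_carrier intro: closedin_Hausdorff_singleton)
  moreover have "A n \<inter> {a \<in> topspace T. \<alpha> a \<in> {x}} \<noteq> {}" for n
    using x compactin_carrier[OF comp] by (fastforce simp: topspace_eq_carrier)
  ultimately have "(\<Inter>n. A n) \<inter> {a \<in> topspace T. \<alpha> a \<in> {x}} \<noteq> {}"
    by (intro nested_compact_meets assms)
  then show "x \<in> \<alpha> ` (\<Inter>n. A n)" by auto
qed

lemma Inter_set_mult_nested:
  assumes comp: "\<And>n::nat. compactin T (A n)" and dec: "\<And>n. A (Suc n) \<subseteq> A n"
    and K: "compactin T K"
  shows "(\<Inter>n. A n <#> K) \<subseteq> (\<Inter>n. A n) <#> K"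
proof
  fix x assume x: "x \<in> (\<Inter>n. A n <#> K)"
  have A: "A n \<subseteq> carrier G" for n using compactin_carrier[OF comp] .
  have Kc: "K \<subseteq> carrier G" using compactin_carrier[OF K] .
  have xc: "x \<in> carrier G" using x A[of 0] Kc set_mult_closed[of "A 0" K] by blast
  let ?P = "{a \<in> topspace T. inv a \<otimes> x \<in> K}"
  have "closedin T ?P"
    using xc K compactin_imp_closedin[OF Hausdorff]
    by (intro closedin_continuous_map_preimage[of T T] continuous_map_group_mult continuous_map_inv)
      (simp_all add: topspace_eq_carrier)
  moreover have "A n \<inter> ?P \<noteq> {}" for n
  proof -
    obtain a k where a: "x = a \<otimes> k" "a \<in> A n" "k \<in> K"
      using x unfolding set_mult_def by blast
    then have "inv a \<otimes> x = k" using A Kc by (simp add: subset_eq m_assoc[symmetric])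
    with a A[of n] have "a \<in> A n \<inter> ?P" by (auto simp: topspace_eq_carrier)
    then show ?thesis by blast
  qed
  ultimately have "(\<Inter>n. A n) \<inter> ?P \<noteq> {}" by (intro nested_compact_meets comp dec)
  then obtain a where a: "a \<in> (\<Inter>n. A n)" "a \<in> carrier G" "inv a \<otimes> x \<in> K"
    by (auto simp: topspace_eq_carrier)
  moreover have "x = a \<otimes> (inv a \<otimes> x)" using a xc by (simp add: m_assoc[symmetric])
  ultimately show "x \<in> (\<Inter>n. A n) <#> K" unfolding set_mult_def by blast
qed

section \<open>Forward orbits\<close>

lemma neg_iff: "x \<in> Neg V n \<longleftrightarrow> x \<in> carrier G \<and> (\<forall>k\<le>n. (\<alpha> ^^ k) x \<in> V)"
  by (auto simp: V_neg_def iter_preimage_def)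

lemma minus_iff: "x \<in> Minus V \<longleftrightarrow> x \<in> carrier G \<and> (\<forall>k. (\<alpha> ^^ k) x \<in> V)"
  by (auto simp: V_minus_def neg_iff)

lemma minus_minus_iff: "x \<in> MinusMinus V \<longleftrightarrow> x \<in> carrier G \<and> (\<exists>n. \<forall>k\<ge>n. (\<alpha> ^^ k) x \<in> V)"
proof -
  have "(\<alpha> ^^ n) x \<in> Minus V \<longleftrightarrow> (\<forall>k\<ge>n. (\<alpha> ^^ k) x \<in> V)" if "x \<in> carrier G" for n
    using that by (auto simp: minus_iff iter_add dest: le_Suc_ex) (metis add.commute le_Suc_ex)
  then show ?thesis by (auto simp: V_minus_minus_def iter_preimage_def)
qed

lemma neg_subset: "Neg V n \<subseteq> V"
  by (force simp: neg_iff)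

lemma minus_subset: "Minus V \<subseteq> V"
  using minus_iff[of _ V] by (metis funpow_0 subsetI)

lemma minus_subset_minus_minus: "Minus V \<subseteq> MinusMinus V"
  by (auto simp: minus_iff minus_minus_iff)

lemma minus_minus_mono: "V \<subseteq> W \<Longrightarrow> MinusMinus V \<subseteq> MinusMinus W"
  by (fastforce simp: minus_minus_iff)

lemma neg_subgroup:
  assumes "subgroup V G" shows "subgroup (Neg V n) G"
proof -
  interpret V: subgroup V G by fact
  show ?thesis
  proof (rule subgroupI)
    show "Neg V n \<noteq> {}" using neg_iff[of \<one> V n] by auto
  qed (auto simp: neg_iff)
qed

lemma minus_subgroup:
  assumes "subgroup V G" shows "subgroup (Minus V) G"
proof -
  interpret V: subgroup V G by fact
  show ?thesis
  proof (rule subgroupI)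
    show "Minus V \<noteq> {}" using minus_iff[of \<one> V] by auto
  qed (auto simp: minus_iff)
qed

lemma minus_minus_subgroup:
  assumes "subgroup V G" shows "subgroup (MinusMinus V) G"
proof -
  interpret V: subgroup V G by fact
  show ?thesis
  proof (rule subgroupI)
    show "MinusMinus V \<noteq> {}" using minus_minus_iff[of \<one> V] by auto
    fix x assume "x \<in> MinusMinus V"
    then obtain n where x: "x \<in> carrier G" "\<forall>k\<ge>n. (\<alpha> ^^ k) x \<in> V" by (auto simp: minus_minus_iff)
    then show "inv x \<in> MinusMinus V" by (auto simp: minus_minus_iff)
    fix y assume "y \<in> MinusMinus V"
    then obtain m where y: "y \<in> carrier G" "\<forall>k\<ge>m. (\<alpha> ^^ k) y \<in> V" by (auto simp: minus_minus_iff)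
    have "(\<alpha> ^^ k) (x \<otimes> y) \<in> V" if "k \<ge> max m n" for k
      using that x y by simp
    then show "x \<otimes> y \<in> MinusMinus V" using x y unfolding minus_minus_iff by blast
  qed (simp add: minus_minus_iff subset_eq)
qed

lemma iter_minus: "x \<in> Minus V \<Longrightarrow> (\<alpha> ^^ n) x \<in> Minus V"
  by (simp add: minus_iff iter_add)

lemma neg_compact_open:
  assumes "cosub V" shows "cosub (Neg V n)"
proof -
  note V = cosubD[OF assms]
  have "openin T (Neg V n)" "closedin T (Neg V n)"
    unfolding V_neg_def iter_preimage_def
    using openin_continuous_map_preimage[OF iter_continuous V(3)]
      closedin_continuous_map_preimage[OF iter_continuous V(4)]
    by (auto simp: topspace_eq_carrier intro!: openin_Inter closedin_Inter)
  then show ?thesis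
    using V neg_subgroup[OF V(1)] closed_compactin[OF V(2) neg_subset]
    by (simp add: compact_open_subgroup_def)
qed

lemma neg_antimono: "Neg V (Suc n) \<subseteq> Neg V n"
  by (auto simp: neg_iff)

lemma minus_compact:
  assumes "cosub V" shows "compactin T (Minus V)"
proof -
  have "closedin T (Minus V)"
    unfolding V_minus_def using cosubD(4)[OF neg_compact_open[OF assms]] by (intro closedin_Inter) auto
  then show ?thesis using closed_compactin[OF cosubD(2)[OF assms] minus_subset] by simp
qed

section \<open>Backward orbits\<close>

lemma pos_subset: "Pos V n \<subseteq> V"
  by (cases n) auto

lemma pos_antimono: "Pos V (Suc n) \<subseteq> Pos V n"
  by (induction n) auto

lemma pos_subgroup:
  assumes "subgroup V G" shows "subgroup (Pos V n) G"
proof (induction n)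
  case (Suc n)
  then show ?case
    using assms iter_subgroup[of "Pos V n" 1] subgroups_Inter_pair[of V "\<alpha> ` Pos V n"] by simp
qed (use assms in simp)

lemma pos_compact:
  assumes "cosub V" shows "compactin T (Pos V n)"
proof (induction n)
  case (Suc n)
  then have "compactin T (\<alpha> ` Pos V n)" using image_compactin[OF Suc iter_continuous[of 1]] by simp
  then show ?case using closed_Int_compactin[OF cosubD(4)[OF assms]] by simp
qed (use assms cosubD in simp)

lemma plus_subset: "Plus V \<subseteq> V"
  unfolding V_plus_def using pos_subset by blast

lemma plus_subgroup:
  assumes "subgroup V G" shows "subgroup (Plus V) G"
  unfolding V_plus_def using pos_subgroup[OF assms] by (intro subgroups_Inter) auto

lemma plus_compact:
  assumes "cosub V" shows "compactin T (Plus V)"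
proof -
  have "closedin T (Plus V)"
    unfolding V_plus_def using compactin_imp_closedin[OF Hausdorff pos_compact[OF assms]]
    by (intro closedin_Inter) auto
  then show ?thesis using closed_compactin[OF cosubD(2)[OF assms] plus_subset] by simp
qed

text \<open>This is where compactness enters the description of \<^term>\<open>V_plus\<close>: an element with
  backward trajectories in \<open>V\<close> of every finite length has an infinite one.\<close>
lemma plus_subset_image:
  assumes "cosub V" shows "Plus V \<subseteq> \<alpha> ` Plus V"
proof -
  have "Plus V \<subseteq> (\<Inter>n. \<alpha> ` Pos V n)"
    unfolding V_plus_def using V_pos.simps(2)[of \<alpha> V] by blast
  also have "\<dots> \<subseteq> \<alpha> ` Plus V"
    unfolding V_plus_def by (intro Inter_image_nested pos_compact assms pos_antimono)
  finally show ?thesis .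
qed

lemma Int_image_plus_subset: "V \<inter> \<alpha> ` Plus V \<subseteq> Plus V"
proof -
  have "V \<inter> \<alpha> ` Plus V \<subseteq> Pos V n" for n
    by (cases n) (auto simp: V_plus_def)
  then show ?thesis unfolding V_plus_def by blast
qed

text \<open>Coinduction for \<^term>\<open>V_plus\<close>: the elements of \<open>S\<close> have backward trajectories that never
  leave \<open>S\<close>.\<close>
lemma subset_plusI:
  assumes "S \<subseteq> V" "S \<subseteq> \<alpha> ` S" shows "S \<subseteq> Plus V"
proof -
  have "S \<subseteq> Pos V n" for n
  proof (induction n)
    case (Suc n)
    then have "\<alpha> ` S \<subseteq> \<alpha> ` Pos V n" by blast
    with assms show ?case by auto
  qed (simp add: assms)
  then show ?thesis unfolding V_plus_def by blast
qed

lemma plus_mono: "cosub V \<Longrightarrow> V \<subseteq> W \<Longrightarrow> Plus V \<subseteq> Plus W"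
  by (meson order_trans plus_subset plus_subset_image subset_plusI)

text \<open>The first \<open>n\<close> terms of a backward trajectory of \<open>v\<close> in \<open>V\<close>, followed down to the
  \<open>n\<close>th term \<open>w\<close>; the point is that the trajectory from \<open>w\<close> back up to \<open>v\<close> stays in \<open>V\<close>.\<close>
lemma plus_pullback:
  assumes "cosub V" "v \<in> Plus V"
  obtains w where "w \<in> Plus V" "w \<in> Neg V n" "(\<alpha> ^^ n) w = v"
proof -
  have "\<exists>w\<in>Plus V. w \<in> Neg V n \<and> (\<alpha> ^^ n) w = v"
  proof (induction n)
    case 0
    with assms plus_subset cosubD(5)[OF assms(1)] show ?case by (force simp: neg_iff)
  next
    case (Suc n)
    then obtain w where w: "w \<in> Plus V" "w \<in> Neg V n" "(\<alpha> ^^ n) w = v" by blast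
    then obtain u where u: "u \<in> Plus V" "\<alpha> u = w" using plus_subset_image[OF assms(1)] by blast
    have uV: "u \<in> V" "u \<in> carrier G" using u plus_subset cosubD(5)[OF assms(1)] by blast+
    have "(\<alpha> ^^ k) u \<in> V" if "k \<le> Suc n" for k
      using that u w uV by (cases k) (auto simp: neg_iff funpow_swap1)
    with u uV w show ?case by (auto simp: neg_iff funpow_swap1 intro!: bexI[of _ u])
  qed
  with that show thesis by blast
qed

lemma plus_subset_iter: "cosub V \<Longrightarrow> Plus V \<subseteq> (\<alpha> ^^ n) ` Plus V"
  using plus_pullback[of V _ n] by blast

lemma iter_plus_mono:
  assumes "cosub V" "m \<le> n" shows "(\<alpha> ^^ m) ` Plus V \<subseteq> (\<alpha> ^^ n) ` Plus V"
proof -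
  have "(\<alpha> ^^ m) ` Plus V \<subseteq> (\<alpha> ^^ m) ` (\<alpha> ^^ (n - m)) ` Plus V"
    using plus_subset_iter[OF assms(1)] by (rule image_mono)
  also have "\<dots> = (\<alpha> ^^ n) ` Plus V"
    using assms(2) by (simp add: image_image iter_add)
  finally show ?thesis .
qed

lemma plus_Int_neg_subset:
  assumes "cosub V" shows "Plus V \<inter> Neg V n \<subseteq> Plus (Neg V n)"
proof (rule subset_plusI)
  show "Plus V \<inter> Neg V n \<subseteq> \<alpha> ` (Plus V \<inter> Neg V n)"
  proof
    fix x assume x: "x \<in> Plus V \<inter> Neg V n"
    then obtain u where u: "u \<in> Plus V" "\<alpha> u = x" using plus_subset_image[OF assms(1)] by blast
    have uV: "u \<in> V" "u \<in> carrier G" using u plus_subset cosubD(5)[OF assms(1)] by blast+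
    have "(\<alpha> ^^ k) u \<in> V" if "k \<le> n" for k
      using that u x uV by (cases k) (auto simp: neg_iff funpow_swap1)
    with u uV show "x \<in> \<alpha> ` (Plus V \<inter> Neg V n)" by (auto simp: neg_iff)
  qed
qed blast

lemma minus_neg: "Minus (Neg V n) = Minus V"
proof -
  have "(\<alpha> ^^ k) ((\<alpha> ^^ l) x) \<in> V" if "\<forall>k. (\<alpha> ^^ k) x \<in> V" for k l x
    using that by (simp add: iter_add)
  then show ?thesis by (force simp: minus_iff neg_iff)
qed

lemma iter_neg_subset_pos:
  assumes "x \<in> Neg V n" "j \<le> n" shows "(\<alpha> ^^ j) x \<in> Pos V j"
  using assms(2)
proof (induction j)
  case (Suc j)
  moreover have "(\<alpha> ^^ Suc j) x \<in> V" using assms Suc by (simp add: neg_iff del: funpow.simps)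
  ultimately show ?case by auto
qed (use assms in \<open>force simp: neg_iff\<close>)

section \<open>Tidiness above\<close>

text \<open>The compact sets \<open>\<alpha> ` Pos V n\<close> decrease to \<open>\<alpha> ` Plus V\<close>, so one of them lies in the open
  neighbourhood \<open>\<alpha> ` Plus V <#> V\<close> of the limit.\<close>
lemma eventually_pos_in_plus_cosets:
  assumes "cosub V" obtains N where "\<alpha> ` Pos V N \<subseteq> \<alpha> ` Plus V <#> V"
proof (rule ccontr)
  note V = cosubD[OF assms]
  have c: "\<alpha> ` Pos V n \<subseteq> carrier G" for n using pos_subset V(5) by blast
  have pc: "\<alpha> ` Plus V \<subseteq> carrier G" using plus_subset V(5) by blast
  let ?P = "topspace T - (\<alpha> ` Plus V <#> V)"
  assume "\<not> thesis"
  then have "\<not> \<alpha> ` Pos V n \<subseteq> \<alpha> ` Plus V <#> V" for n using that by blast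
  then have ne: "\<alpha> ` Pos V n \<inter> ?P \<noteq> {}" for n using c[of n] by (auto simp: topspace_eq_carrier)
  have "(\<Inter>n. \<alpha> ` Pos V n) \<inter> ?P \<noteq> {}"
  proof (rule nested_compact_meets[OF _ _ _ ne])
    show "compactin T (\<alpha> ` Pos V n)" for n
      using image_compactin[OF pos_compact[OF assms] iter_continuous[of 1]] by simp
    show "\<alpha> ` Pos V (Suc n) \<subseteq> \<alpha> ` Pos V n" for n by (intro image_mono pos_antimono)
    show "closedin T ?P" using openin_set_mult[OF pc V(3)] by blast
  qed
  moreover have "(\<Inter>n. \<alpha> ` Pos V n) \<subseteq> \<alpha> ` Plus V"
    unfolding V_plus_def by (intro Inter_image_nested pos_compact assms pos_antimono)
  moreover have "\<alpha> ` Plus V \<subseteq> \<alpha> ` Plus V <#> V"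
    using subgroup.one_closed[OF V(1)] pc by (force simp: set_mult_def)
  ultimately show False by blast
qed

text \<open>Let \<open>N\<close> be as in the previous lemma and let \<open>x\<close> have its orbit in \<open>V\<close> up to some time
  \<open>M \<ge> N\<close>. Then \<open>\<alpha>\<^bsup>M+1\<^esup>(x)\<close> agrees with some \<open>\<alpha>(v)\<close>, \<open>v \<in> Plus V\<close>, up to an element of \<open>V\<close>; dividing
  \<open>x\<close> by a preimage \<open>w\<close> of \<open>v\<close> under \<open>\<alpha>\<^bsup>M\<^esup>\<close> lengthens the stay in \<open>V\<close> by one step, and \<open>w\<close> can be
  taken in \<open>Plus V \<inter> Neg V M\<close>. Iterating and passing to the limit, one divides \<open>x\<close> by an element
  of \<open>Plus V \<inter> Neg V N\<close> and lands in \<open>Minus V\<close>.\<close>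
theorem neg_tidy_above:
  assumes "cosub V" obtains n where "tidy_above G \<alpha> (Neg V n)"
proof -
  note V = cosubD[OF assms]
  interpret V: subgroup V G using V by simp
  obtain N where N: "\<alpha> ` Pos V N \<subseteq> \<alpha> ` Plus V <#> V"
    using eventually_pos_in_plus_cosets[OF assms] .
  have posN: "Pos V M \<subseteq> Pos V N" if "M \<ge> N" for M
    using that pos_antimono by (simp add: lift_Suc_antimono_le)
  have pc: "Plus V \<subseteq> carrier G" using plus_subset V(5) by blast
  have step: "\<exists>w. w \<in> Plus V \<and> w \<in> Neg V M \<and> inv w \<otimes> x \<in> Neg V (Suc M)"
    if x: "x \<in> Neg V M" and "M \<ge> N" for x M
  proof -
    have xc: "x \<in> carrier G" using x by (simp add: neg_iff)
    have "(\<alpha> ^^ M) x \<in> Pos V N" using iter_neg_subset_pos[OF x] posN[OF \<open>M \<ge> N\<close>] by blast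
    then obtain v u where v: "v \<in> Plus V" "u \<in> V" "\<alpha> ((\<alpha> ^^ M) x) = \<alpha> v \<otimes> u"
      using N by (auto simp: set_mult_def subset_eq)
    obtain w where w: "w \<in> Plus V" "w \<in> Neg V M" "(\<alpha> ^^ M) w = v"
      using plus_pullback[OF assms v(1)] .
    have wc: "w \<in> carrier G" and vc: "v \<in> carrier G" using w pc v by blast+
    have "(\<alpha> ^^ Suc M) (inv w \<otimes> x) = u"
      using v w wc xc vc V.mem_carrier[OF v(2)] iter_mult[of "inv w" x "Suc M"] iter_inv[of w "Suc M"]
      by (simp add: m_assoc[symmetric])
    moreover have "(\<alpha> ^^ k) (inv w \<otimes> x) \<in> V" if "k \<le> M" for k
      using that x w wc by (simp add: neg_iff)
    ultimately have "inv w \<otimes> x \<in> Neg V (Suc M)"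
      using v wc xc by (auto simp: neg_iff le_Suc_eq simp del: funpow.simps)
    with w show ?thesis by blast
  qed
  let ?P = "Plus V \<inter> Neg V N"
  have Psub: "subgroup ?P G"
    by (intro subgroups_Inter_pair plus_subgroup neg_subgroup V)
  interpret P: subgroup ?P G by fact
  have anti: "Neg V (N + n) \<subseteq> Neg V N" for n by (auto simp: neg_iff)
  have fin: "x \<in> Neg V N \<Longrightarrow> \<exists>p\<in>?P. inv p \<otimes> x \<in> Neg V (N + n)" for x n
  proof (induction n)
    case 0
    then show ?case using P.one_closed by (intro bexI[of _ \<one>]) (simp_all add: neg_iff)
  next
    case (Suc n)
    then obtain p where p: "p \<in> ?P" "inv p \<otimes> x \<in> Neg V (N + n)" by blast
    obtain w where w: "w \<in> Plus V" "w \<in> Neg V (N + n)" "inv w \<otimes> (inv p \<otimes> x) \<in> Neg V (Suc (N + n))"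
      using step[OF p(2)] by auto
    have wP: "w \<in> ?P" using w anti by blast
    moreover have "x \<in> carrier G" using Suc.prems by (simp add: neg_iff)
    ultimately have "inv w \<otimes> (inv p \<otimes> x) = inv (p \<otimes> w) \<otimes> x"
      using p(1) P.mem_carrier by (simp add: inv_mult_group m_assoc)
    with w have "inv (p \<otimes> w) \<otimes> x \<in> Neg V (N + Suc n)" by simp
    then show ?case using P.m_closed[OF p(1) wP] by blast
  qed
  have "Neg V N \<subseteq> ?P <#> Minus V"
  proof
    fix x assume x: "x \<in> Neg V N"
    have xc: "x \<in> carrier G" using x by (simp add: neg_iff)
    have Pcomp: "compactin T ?P"
      using compactin_Int[OF Hausdorff plus_compact[OF assms] cosubD(2)[OF neg_compact_open[OF assms]]] .
    \<comment> \<open>The limit argument needs the shrinking factor on the left, hence the inverses.\<close>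
    have "inv x \<in> Neg V (N + n) <#> ?P" for n
    proof -
      obtain p where p: "p \<in> ?P" "inv p \<otimes> x \<in> Neg V (N + n)" using fin[OF x] by blast
      have "inv x = inv (inv p \<otimes> x) \<otimes> inv p"
        using P.mem_carrier[OF p(1)] xc by (simp add: inv_mult_group m_assoc)
      moreover have "inv (inv p \<otimes> x) \<in> Neg V (N + n)"
        using subgroup.m_inv_closed[OF neg_subgroup[OF V(1)] p(2)] .
      ultimately show ?thesis using P.m_inv_closed[OF p(1)] unfolding set_mult_def by blast
    qed
    then have "inv x \<in> (\<Inter>n. Neg V (N + n)) <#> ?P"
      using Inter_set_mult_nested[of "\<lambda>n. Neg V (N + n)" ?P] cosubD(2)[OF neg_compact_open[OF assms]]
        neg_antimono Pcomp by force
    then obtain a p where a: "inv x = a \<otimes> p" "a \<in> (\<Inter>n. Neg V (N + n))" "p \<in> ?P"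
      by (auto simp: set_mult_def)
    have am: "a \<in> Minus V"
      unfolding minus_iff
    proof (intro conjI allI)
      show "a \<in> carrier G" using a(2) by (auto simp: neg_iff)
      show "(\<alpha> ^^ k) a \<in> V" for k
        using INT_D[OF a(2), of k] by (simp add: neg_iff)
    qed
    then have ac: "a \<in> carrier G" by (simp add: minus_iff)
    have "x = inv p \<otimes> inv a"
      using a(1) ac P.mem_carrier[OF a(3)] xc by (metis inv_inv inv_mult_group)
    moreover have "inv a \<in> Minus V" using subgroup.m_inv_closed[OF minus_subgroup[OF V(1)] am] .
    ultimately show "x \<in> ?P <#> Minus V"
      using P.m_inv_closed[OF a(3)] unfolding set_mult_def by blast
  qed
  also have "\<dots> \<subseteq> Plus (Neg V N) <#> Minus (Neg V N)"
    unfolding minus_neg by (intro mono_set_mult plus_Int_neg_subset assms order_refl)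
  finally have "Neg V N \<subseteq> Plus (Neg V N) <#> Minus (Neg V N)" .
  moreover have "Plus (Neg V N) <#> Minus (Neg V N) \<subseteq> Neg V N"
    using plus_subset[of "Neg V N"] minus_subset[of "Neg V N"]
      subgroup.m_closed[OF neg_subgroup[OF V(1)]] by (auto simp: set_mult_def subset_eq)
  ultimately show thesis using that[of N] by (auto simp: tidy_above_def)
qed

section \<open>Homoclinic elements\<close>

text \<open>The elements with a two-sided trajectory that lies in \<open>V\<close> at all sufficiently early and
  all sufficiently late times. In between it may leave \<open>V\<close>; these excursions are the
  obstruction to tidiness below.\<close>
definition homoclinic :: "'a set \<Rightarrow> 'a set" where
  "homoclinic V = (\<Union>m. (\<alpha> ^^ m) ` Plus V) \<inter> MinusMinus V"

lemma homoclinic_subgroup: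
  assumes "cosub V" shows "subgroup (homoclinic V) G"
proof -
  have P: "subgroup ((\<alpha> ^^ m) ` Plus V) G" for m
    using assms cosubD(1) plus_subgroup iter_subgroup by blast
  have "subgroup (\<Union>m. (\<alpha> ^^ m) ` Plus V) G"
  proof (rule subgroupI)
    show "(\<Union>m. (\<alpha> ^^ m) ` Plus V) \<subseteq> carrier G" using subgroup.subset[OF P] by blast
    show "(\<Union>m. (\<alpha> ^^ m) ` Plus V) \<noteq> {}" using subgroup.one_closed[OF P[of 0]] by blast
    fix x assume "x \<in> (\<Union>m. (\<alpha> ^^ m) ` Plus V)"
    then obtain m where m: "x \<in> (\<alpha> ^^ m) ` Plus V" by blast
    then show "inv x \<in> (\<Union>m. (\<alpha> ^^ m) ` Plus V)"
      using subgroup.m_inv_closed[OF P[of m]] by blast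
    fix y assume "y \<in> (\<Union>m. (\<alpha> ^^ m) ` Plus V)"
    then obtain n where n: "y \<in> (\<alpha> ^^ n) ` Plus V" by blast
    have "x \<in> (\<alpha> ^^ max m n) ` Plus V" "y \<in> (\<alpha> ^^ max m n) ` Plus V"
      using subsetD[OF iter_plus_mono[OF assms max.cobounded1] m]
        subsetD[OF iter_plus_mono[OF assms max.cobounded2] n] .
    then show "x \<otimes> y \<in> (\<Union>m. (\<alpha> ^^ m) ` Plus V)"
      using subgroup.m_closed[OF P[of "max m n"]] by blast
  qed
  then show ?thesis
    unfolding homoclinic_def using minus_minus_subgroup[OF cosubD(1)[OF assms]]
    by (rule subgroups_Inter_pair)
qed

lemma homoclinic_mono: "cosub V \<Longrightarrow> V \<subseteq> W \<Longrightarrow> homoclinic V \<subseteq> homoclinic W"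
  unfolding homoclinic_def using plus_mono[of V W] minus_minus_mono[of V W] by blast

lemma plus_Int_minus_minus_subset_homoclinic: "Plus V \<inter> MinusMinus V \<subseteq> homoclinic V"
proof -
  have "Plus V = (\<alpha> ^^ 0) ` Plus V" by simp
  then show ?thesis unfolding homoclinic_def by blast
qed

lemma minus_minus_iter_iff:
  assumes "x \<in> carrier G" shows "(\<alpha> ^^ m) x \<in> MinusMinus V \<longleftrightarrow> x \<in> MinusMinus V"
proof
  assume "(\<alpha> ^^ m) x \<in> MinusMinus V"
  then obtain n where n: "\<forall>k\<ge>n. (\<alpha> ^^ k) ((\<alpha> ^^ m) x) \<in> V" by (auto simp: minus_minus_iff)
  have "(\<alpha> ^^ k) x \<in> V" if "k \<ge> n + m" for k
    using n[rule_format, of "k - m"] that by (simp add: iter_add)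
  then show "x \<in> MinusMinus V" using assms by (auto simp: minus_minus_iff)
next
  assume "x \<in> MinusMinus V"
  then obtain n where "\<forall>k\<ge>n. (\<alpha> ^^ k) x \<in> V" by (auto simp: minus_minus_iff)
  then have "\<forall>k\<ge>n. (\<alpha> ^^ k) ((\<alpha> ^^ m) x) \<in> V" by (simp add: iter_add)
  then show "(\<alpha> ^^ m) x \<in> MinusMinus V" using assms unfolding minus_minus_iff by blast
qed

lemma image_homoclinic: "cosub V \<Longrightarrow> \<alpha> ` homoclinic V \<subseteq> homoclinic V"
proof
  fix y assume V: "cosub V" and "y \<in> \<alpha> ` homoclinic V"
  then obtain m p where p: "y = \<alpha> ((\<alpha> ^^ m) p)" "p \<in> Plus V" "(\<alpha> ^^ m) p \<in> MinusMinus V"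
    by (auto simp: homoclinic_def)
  have pc: "p \<in> carrier G" using p plus_subset cosubD(5)[OF V] by blast
  have "y = (\<alpha> ^^ Suc m) p" using p by simp
  moreover have "(\<alpha> ^^ Suc m) p \<in> MinusMinus V"
    using p(3) minus_minus_iter_iff[OF pc, of "Suc m" V] minus_minus_iter_iff[OF pc, of m V] by (simp only:)
  ultimately show "y \<in> homoclinic V" using p unfolding homoclinic_def by blast
qed

text \<open>Modulo elements whose whole past lies in \<open>V\<close>, only finitely many excursions begin at a
  given time: \<open>H = Plus V \<inter> MinusMinus V\<close> has finite index in its image under \<open>\<alpha>\<close>. Hence
  \<open>\<alpha>\<^bsup>n+1\<^esup>(H) \<subseteq> \<alpha>\<^bsup>n\<^esup>(F) \<alpha>\<^bsup>n\<^esup>(H)\<close> for a finite set \<open>F\<close> of representatives. Each of these ends up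
  in \<open>V\<close> for good, so \<open>\<alpha>\<^bsup>n\<^esup>(F) \<subseteq> V\<close> as soon as \<open>n \<ge> M\<close>, and since \<open>V V = V\<close> the sets \<open>\<alpha>\<^bsup>n\<^esup>(H)\<close> do not
  grow beyond \<open>V \<alpha>\<^bsup>M\<^esup>(Plus V)\<close> any more.\<close>
lemma homoclinic_bounded:
  assumes "cosub V" obtains M where "homoclinic V \<subseteq> V <#> (\<alpha> ^^ M) ` Plus V"
proof -
  note V = cosubD[OF assms]
  interpret V: subgroup V G by (fact V(1))
  have pc: "Plus V \<subseteq> carrier G" using plus_subset V(5) by blast
  have Psub: "subgroup ((\<alpha> ^^ m) ` Plus V) G" for m
    using V(1) plus_subgroup iter_subgroup by blast
  let ?H = "Plus V \<inter> MinusMinus V"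
  obtain F0 where F0: "finite F0" "\<alpha> ` Plus V \<subseteq> F0 <#> V" "F0 \<subseteq> \<alpha> ` Plus V"
  proof -
    have "compactin T (\<alpha> ` Plus V)"
      using image_compactin[OF plus_compact[OF assms] iter_continuous[of 1]] by simp
    from finite_coset_cover[OF this V(1,3)] show thesis using that by metis
  qed
  have F0c: "F0 \<subseteq> carrier G" using F0 pc by blast
  \<comment> \<open>A coset representative may only be chosen inside \<open>MinusMinus V\<close>, since it has to return
      to \<open>V\<close>.\<close>
  define rep where "rep f = (SOME y. y \<in> \<alpha> ` Plus V \<inter> MinusMinus V \<inter> (f <# V))" for f
  define F where "F = rep ` {f \<in> F0. \<alpha> ` Plus V \<inter> MinusMinus V \<inter> (f <# V) \<noteq> {}}"
  have rep: "rep f \<in> \<alpha> ` Plus V \<inter> MinusMinus V \<inter> (f <# V)"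
    if "\<alpha> ` Plus V \<inter> MinusMinus V \<inter> (f <# V) \<noteq> {}" for f
    using that unfolding rep_def by (simp add: some_in_eq del: Int_iff)
  have F_mm: "F \<subseteq> MinusMinus V" unfolding F_def using rep by blast
  have decomp: "\<exists>f\<in>F. inv f \<otimes> x \<in> ?H" if x: "x \<in> \<alpha> ` Plus V \<inter> MinusMinus V" for x
  proof -
    obtain f v where f: "f \<in> F0" "v \<in> V" "x = f \<otimes> v" using x F0(2) by (auto simp: set_mult_def)
    then have ne: "\<alpha> ` Plus V \<inter> MinusMinus V \<inter> (f <# V) \<noteq> {}"
      using x unfolding l_coset_def by blast
    from rep[OF ne] obtain w where w: "w \<in> V" "rep f = f \<otimes> w" by (auto simp: l_coset_def)
    have c: "f \<in> carrier G" "v \<in> carrier G" "w \<in> carrier G" using f w F0c V(5) by blast+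
    have "inv f \<otimes> (f \<otimes> v) = v" using c by (simp add: m_assoc[symmetric])
    then have "inv (rep f) \<otimes> x = inv w \<otimes> v" using c w f by (simp add: inv_mult_group m_assoc)
    then have "inv (rep f) \<otimes> x \<in> V" using f w by simp
    moreover have "inv (rep f) \<otimes> x \<in> \<alpha> ` Plus V"
      using rep[OF ne] x subgroup.m_closed[OF Psub[of 1]] subgroup.m_inv_closed[OF Psub[of 1]]
      by simp
    moreover have "inv (rep f) \<otimes> x \<in> MinusMinus V"
      using rep[OF ne] x subgroup.m_closed[OF minus_minus_subgroup[OF V(1)]]
        subgroup.m_inv_closed[OF minus_minus_subgroup[OF V(1)]]
      by simp
    moreover have "rep f \<in> F" using f ne unfolding F_def by blast
    ultimately show ?thesis using Int_image_plus_subset[of V] by blast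
  qed
  have "finite F" using F0 by (simp add: F_def)
  then have "\<exists>M. \<forall>f\<in>F. \<forall>k\<ge>M. (\<alpha> ^^ k) f \<in> V" using F_mm
  proof (induction F)
    case (insert f F)
    then obtain M N where "\<forall>f\<in>F. \<forall>k\<ge>M. (\<alpha> ^^ k) f \<in> V" "\<forall>k\<ge>N. (\<alpha> ^^ k) f \<in> V"
      by (auto simp: minus_minus_iff)
    then have "\<forall>g\<in>insert f F. \<forall>k\<ge>max M N. (\<alpha> ^^ k) g \<in> V" by simp
    then show ?case by blast
  qed simp
  then obtain M where M: "\<And>f k. f \<in> F \<Longrightarrow> k \<ge> M \<Longrightarrow> (\<alpha> ^^ k) f \<in> V" by blast
  have PM: "(\<alpha> ^^ M) ` Plus V \<subseteq> V <#> (\<alpha> ^^ M) ` Plus V"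
  proof
    fix y assume y: "y \<in> (\<alpha> ^^ M) ` Plus V"
    then have "y = \<one> \<otimes> y" using pc by auto
    with y V.one_closed show "y \<in> V <#> (\<alpha> ^^ M) ` Plus V" unfolding set_mult_def by blast
  qed
  have bound: "(\<alpha> ^^ n) ` ?H \<subseteq> V <#> (\<alpha> ^^ M) ` Plus V" for n
  proof (induction n)
    case 0
    show ?case using plus_subset_iter[OF assms, of M] PM by auto
  next
    case (Suc n)
    show ?case
    proof (cases "Suc n \<le> M")
      case True
      then show ?thesis using iter_plus_mono[OF assms True] PM by blast
    next
      case False
      show ?thesis
      proof
        fix z assume "z \<in> (\<alpha> ^^ Suc n) ` ?H"
        then obtain h where h: "h \<in> ?H" "z = (\<alpha> ^^ n) (\<alpha> h)" by (auto simp: funpow_swap1)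
        have hc: "h \<in> carrier G" using h pc by blast
        have "\<alpha> h \<in> \<alpha> ` Plus V \<inter> MinusMinus V" using h hc minus_minus_iter_iff[of h 1 V] by auto
        from decomp[OF this] obtain f where f: "f \<in> F" "inv f \<otimes> \<alpha> h \<in> ?H" by blast
        have fc: "f \<in> carrier G" using f(1) F_mm by (auto simp: minus_minus_iff)
        have "f \<otimes> (inv f \<otimes> \<alpha> h) = \<alpha> h" using fc hc by (simp add: m_assoc[symmetric])
        then have z: "z = (\<alpha> ^^ n) f \<otimes> (\<alpha> ^^ n) (inv f \<otimes> \<alpha> h)"
          using h(2) fc hc iter_mult[of f "inv f \<otimes> \<alpha> h" n]
          by (metis \<alpha>_closed inv_closed m_closed)
        have "(\<alpha> ^^ n) (inv f \<otimes> \<alpha> h) \<in> V <#> (\<alpha> ^^ M) ` Plus V" using Suc f(2) by blast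
        then obtain v p where v: "v \<in> V" "p \<in> Plus V"
          "(\<alpha> ^^ n) (inv f \<otimes> \<alpha> h) = v \<otimes> (\<alpha> ^^ M) p"
          by (auto simp: set_mult_def)
        have "(\<alpha> ^^ n) f \<in> V" using M[OF f(1)] False by simp
        moreover have "z = ((\<alpha> ^^ n) f \<otimes> v) \<otimes> (\<alpha> ^^ M) p"
          using z v fc V(5) pc by (simp add: m_assoc subset_eq)
        ultimately show "z \<in> V <#> (\<alpha> ^^ M) ` Plus V"
          using v unfolding set_mult_def by blast
      qed
    qed
  qed
  have "homoclinic V \<subseteq> (\<Union>n. (\<alpha> ^^ n) ` ?H)"
  proof
    fix x assume "x \<in> homoclinic V"
    then obtain m p where p: "x = (\<alpha> ^^ m) p" "p \<in> Plus V" "(\<alpha> ^^ m) p \<in> MinusMinus V"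
      by (auto simp: homoclinic_def)
    then have "p \<in> ?H" using pc minus_minus_iter_iff[of p m V] by blast
    with p(1) show "x \<in> (\<Union>n. (\<alpha> ^^ n) ` ?H)" by blast
  qed
  with bound that show thesis by blast
qed

abbreviation "Hcl V \<equiv> cl (homoclinic V)"

lemma homoclinic_subset_Hcl: "cosub V \<Longrightarrow> homoclinic V \<subseteq> Hcl V"
  using homoclinic_subgroup subgroup.subset closure_of_subset topspace_eq_carrier by metis

lemma Hcl_subgroup: "cosub V \<Longrightarrow> subgroup (Hcl V) G"
  using homoclinic_subgroup closure_of_subgroup by blast

lemma Hcl_compact:
  assumes "cosub V" shows "compactin T (Hcl V)"
proof -
  obtain M where M: "homoclinic V \<subseteq> V <#> (\<alpha> ^^ M) ` Plus V" using homoclinic_bounded[OF assms] .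
  have c: "compactin T (V <#> (\<alpha> ^^ M) ` Plus V)"
    by (intro compactin_set_mult image_compactin[OF _ iter_continuous] plus_compact cosubD assms)
  then have "Hcl V \<subseteq> V <#> (\<alpha> ^^ M) ` Plus V"
    using M compactin_imp_closedin[OF Hausdorff] by (intro closure_of_minimal)
  then show ?thesis using c closed_compactin closedin_closure_of by metis
qed

lemma iter_Hcl:
  assumes "cosub V" "k \<in> Hcl V" shows "(\<alpha> ^^ n) k \<in> Hcl V"
proof (induction n)
  case (Suc n)
  have "\<alpha> ` Hcl V \<subseteq> cl (\<alpha> ` homoclinic V)"
    using continuous_map_image_closure_subset[OF iter_continuous[of 1]] by simp
  also have "\<dots> \<subseteq> Hcl V" by (intro closure_of_mono image_homoclinic assms)
  finally show ?case using Suc by auto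
qed (use assms in simp)

section \<open>Bounded forward orbits\<close>

text \<open>Since \<open>C\<close> meets only finitely many cosets of \<open>V\<close>, those among them that meet
  \<open>\<alpha>\<^bsup>n\<^esup>(Plus V)\<close> are the same for all \<open>n \<ge> m\<close>. So \<open>\<alpha>\<^bsup>m+j\<^esup>(v)\<close> differs from an element of
  \<open>\<alpha>\<^bsup>m\<^esup>(Plus V)\<close> by an element of \<open>V = Plus V <#> Minus V\<close>, and the factor in \<open>Plus V\<close> can be
  absorbed. Pulling back along \<open>\<alpha>\<^bsup>j\<^esup>\<close> writes \<open>v\<close> as an element \<open>w'\<close> of \<open>Neg V j\<close> times one that lies in
  \<open>Plus V\<close> and reaches \<open>Minus V\<close>, that is, a homoclinic one. Now let \<open>j\<close> tend to infinity.\<close>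
lemma bounded_orbit_decomposition:
  assumes "cosub V" "tidy_above G \<alpha> V" "compactin T C"
    and v: "v \<in> Plus V" "\<And>n. (\<alpha> ^^ n) v \<in> C"
  shows "v \<in> Minus V <#> Hcl V"
proof -
  note V = cosubD[OF assms(1)]
  interpret V: subgroup V G by (fact V(1))
  have pc: "Plus V \<subseteq> carrier G" using plus_subset V(5) by blast
  have Psub: "subgroup ((\<alpha> ^^ m) ` Plus V) G" for m
    using V(1) plus_subgroup iter_subgroup by blast
  have PM: "Plus V <#> Minus V = V" using assms(2) by (simp only: tidy_above_def)
  have vc: "v \<in> carrier G" using v(1) pc by blast
  obtain F where F: "finite F" "C \<subseteq> F <#> V" "F \<subseteq> C"
    using finite_coset_cover[OF assms(3) V(1,3)] .
  have Fc: "F \<subseteq> carrier G" using F assms(3) compactin_carrier by blast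
  define A where "A m = {g \<in> F. (g <# V) \<inter> (\<alpha> ^^ m) ` Plus V \<noteq> {}}" for m
  have Amono: "A m \<subseteq> A n" if "m \<le> n" for m n
    using iter_plus_mono[OF assms(1) that] unfolding A_def by blast
  \<comment> \<open>An increasing sequence of subsets of \<open>F\<close> is constant from the index on at which its
      cardinality is maximal.\<close>
  obtain m where mx: "card (A n) \<le> card (A m)" for n
    using ex_has_greatest_nat[of "\<lambda>_. True" 0 "\<lambda>n. card (A n)" "Suc (card F)"]
      card_mono[OF F(1), of "A _"] by (auto simp: A_def less_Suc_eq_le)
  have m: "A n = A m" if "n \<ge> m" for n
    using card_seteq[OF _ Amono[OF that] mx] F(1) by (simp add: A_def)
  have key: "v \<in> Neg V j <#> Hcl V" for j
  proof -
    let ?n = "m + j"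
    have "(\<alpha> ^^ ?n) v \<in> F <#> V" using v(2) F(2) by blast
    then obtain g a where g: "g \<in> F" "a \<in> V" "(\<alpha> ^^ ?n) v = g \<otimes> a"
      unfolding set_mult_def by blast
    then have "g \<in> A ?n" using v(1) unfolding A_def l_coset_def by blast
    then have "g \<in> A m" using m[of ?n] by simp
    then obtain b w where b: "b \<in> V" "w \<in> Plus V" "(\<alpha> ^^ m) w = g \<otimes> b"
      unfolding A_def l_coset_def by auto
    have c: "g \<in> carrier G" "a \<in> carrier G" "b \<in> carrier G" "w \<in> carrier G"
      using g b Fc V(5) pc by blast+
    have "inv b \<otimes> a \<in> Plus V <#> Minus V"
      using g(2) b(1) by (simp add: PM)
    then obtain p q where p: "p \<in> Plus V" "q \<in> Minus V" "inv b \<otimes> a = p \<otimes> q"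
      unfolding set_mult_def by blast
    have pq: "p \<in> carrier G" "q \<in> carrier G" using p pc by (auto simp: minus_iff)
    have "p \<in> (\<alpha> ^^ m) ` Plus V" using p(1) plus_subset_iter[OF assms(1)] by blast
    then have "(\<alpha> ^^ m) w \<otimes> p \<in> (\<alpha> ^^ m) ` Plus V"
      using b(2) by (intro subgroup.m_closed[OF Psub]) auto
    then obtain w1 where w1: "w1 \<in> Plus V" "(\<alpha> ^^ m) w1 = (\<alpha> ^^ m) w \<otimes> p" by auto
    obtain w' where w': "w' \<in> Plus V" "w' \<in> Neg V j" "(\<alpha> ^^ j) w' = w1"
      using plus_pullback[OF assms(1) w1(1)] .
    have w'c: "w' \<in> carrier G" using w' pc by blast
    have "(\<alpha> ^^ ?n) v = g \<otimes> b \<otimes> (inv b \<otimes> a)"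
      using c g(3) by (simp add: m_assoc)
    also have "\<dots> = (\<alpha> ^^ ?n) w' \<otimes> q"
      using w'(3) w1(2) b(3) p(3) pq c by (simp add: m_assoc flip: iter_add)
    finally have "(\<alpha> ^^ ?n) (inv w' \<otimes> v) = q"
      using w'c vc pq by simp
    then have "inv w' \<otimes> v \<in> MinusMinus V"
      using p(2) minus_subset_minus_minus w'c vc minus_minus_iter_iff[of "inv w' \<otimes> v" ?n V] by auto
    moreover have "inv w' \<otimes> v \<in> Plus V"
      using w'(1) v(1) plus_subgroup[OF V(1)] by (simp add: subgroup.m_closed subgroup.m_inv_closed)
    ultimately have "inv w' \<otimes> v \<in> Hcl V"
      using plus_Int_minus_minus_subset_homoclinic homoclinic_subset_Hcl[OF assms(1)] by blast
    moreover have "v = w' \<otimes> (inv w' \<otimes> v)" using w'c vc by simp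
    ultimately show ?thesis using w'(2) unfolding set_mult_def by blast
  qed
  have "v \<in> (\<Inter>j. Neg V j) <#> Hcl V"
    using Inter_set_mult_nested[of "Neg V" "Hcl V"] cosubD(2)[OF neg_compact_open[OF assms(1)]]
      neg_antimono Hcl_compact[OF assms(1)] key by blast
  then show ?thesis by (simp add: V_minus_def)
qed

text \<open>A two-sided trajectory that lies in \<open>W\<close> near both ends is bounded. At an early time its value is
  \<open>z = a \<otimes> l\<close> with \<open>a \<in> V = Minus V <#> Plus V\<close>, and the factor in \<open>Plus V\<close> has a bounded orbit as
  well, so \<open>z \<in> Minus V <#> Hcl V\<close> by the preceding lemma. Starting ever earlier gives
  \<open>x \<in> (\<Inter>n. \<alpha>\<^bsup>n\<^esup>(Minus V)) <#> Hcl V\<close>, and the elements of the intersection have entire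
  trajectories in \<open>V\<close>.\<close>
lemma homoclinic_subset_Hcl_if_subset:
  assumes "cosub V" "tidy_above G \<alpha> V" "cosub W" "W \<subseteq> V <#> Hcl V"
  shows "homoclinic W \<subseteq> Hcl V"
proof
  fix x assume "x \<in> homoclinic W"
  then obtain m y p where y: "y \<in> Plus W" "x = (\<alpha> ^^ m) y" "\<And>k. k \<ge> p \<Longrightarrow> (\<alpha> ^^ k) x \<in> W"
    by (auto simp: homoclinic_def minus_minus_iff)
  note V = cosubD[OF assms(1)] and W = cosubD[OF assms(3)]
  interpret V: subgroup V G by (fact V(1))
  have PM: "Plus V <#> Minus V = V" using assms(2) by (simp only: tidy_above_def)
  interpret K: subgroup "Hcl V" G by (rule Hcl_subgroup[OF assms(1)])
  have yc: "y \<in> carrier G" using y(1) plus_subset W(5) by blast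
  have in_n: "x \<in> (\<alpha> ^^ n) ` Minus V <#> Hcl V" for n
  proof -
    obtain z where z: "z \<in> Plus W" "(\<alpha> ^^ n) z = y"
      using plus_pullback[OF assms(3) y(1)] by metis
    have "z \<in> W" using z(1) plus_subset by blast
    then have zc: "z \<in> carrier G" and "z \<in> V <#> Hcl V" using W(5) assms(4) by blast+
    then obtain a l where a: "a \<in> V" "l \<in> Hcl V" "z = a \<otimes> l" unfolding set_mult_def by blast
    have "inv a \<in> Plus V <#> Minus V"
      using a(1) by (simp add: PM)
    then obtain r s where r: "r \<in> Plus V" "s \<in> Minus V" "inv a = r \<otimes> s"
      unfolding set_mult_def by blast
    have c: "a \<in> carrier G" "l \<in> carrier G" "r \<in> carrier G" "s \<in> carrier G"
      using a r V(5) K.subset plus_subset by (auto simp: minus_iff subset_eq)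
    have sV: "inv s \<in> Minus V"
      using subgroup.m_inv_closed[OF minus_subgroup[OF V(1)] r(2)] .
    have za: "z = inv s \<otimes> (inv r \<otimes> l)"
    proof -
      have "a = inv s \<otimes> inv r" using r(3) c by (metis inv_inv inv_mult_group)
      then show ?thesis using a(3) c by (simp add: m_assoc)
    qed
    \<comment> \<open>From time \<open>m + n + p\<close> on the orbit of \<open>z\<close> lies in \<open>W\<close>.\<close>
    let ?C0 = "(\<lambda>j. (\<alpha> ^^ j) z) ` {..<m + n + p} \<union> W"
    have orbit: "(\<alpha> ^^ j) z \<in> ?C0" for j
    proof (cases "j < m + n + p")
      case False
      have "(\<alpha> ^^ j) z = (\<alpha> ^^ (j - (m + n))) x"
        unfolding y(2) z(2)[symmetric] using False by (simp add: iter_add)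
      then show ?thesis using y(3) False by simp
    qed auto
    have C0: "compactin T ?C0"
      using zc by (intro compactin_Un finite_imp_compactin W) (auto simp: topspace_eq_carrier)
    have C: "compactin T (V <#> ?C0 <#> Hcl V)"
      by (intro compactin_set_mult V C0 Hcl_compact assms)
    have "(\<alpha> ^^ j) (inv r) \<in> V <#> ?C0 <#> Hcl V" for j
    proof -
      have "inv r = s \<otimes> z \<otimes> inv l" using za c by (simp add: m_assoc)
      then have "(\<alpha> ^^ j) (inv r) = (\<alpha> ^^ j) s \<otimes> (\<alpha> ^^ j) z \<otimes> (\<alpha> ^^ j) (inv l)"
        using c zc by simp
      moreover have "(\<alpha> ^^ j) s \<in> V" using r(2) by (simp add: minus_iff)
      moreover have "(\<alpha> ^^ j) (inv l) \<in> Hcl V" using a(2) iter_Hcl[OF assms(1)] by blast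
      ultimately show ?thesis using orbit[of j] unfolding set_mult_def by blast
    qed
    moreover have "inv r \<in> Plus V"
      using subgroup.m_inv_closed[OF plus_subgroup[OF V(1)] r(1)] .
    ultimately have "inv r \<in> Minus V <#> Hcl V"
      using bounded_orbit_decomposition[OF assms(1,2) C] by blast
    then obtain t k where t: "t \<in> Minus V" "k \<in> Hcl V" "inv r = t \<otimes> k"
      unfolding set_mult_def by blast
    have tc: "t \<in> carrier G" "k \<in> carrier G" using t K.subset by (auto simp: minus_iff)
    have "inv s \<otimes> t \<in> Minus V" "k \<otimes> l \<in> Hcl V"
      using t sV a(2) subgroup.m_closed[OF minus_subgroup[OF V(1)]] by auto
    moreover have "z = (inv s \<otimes> t) \<otimes> (k \<otimes> l)" using za t(3) c tc by (simp add: m_assoc)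
    ultimately obtain t' k' where t': "t' \<in> Minus V" "k' \<in> Hcl V" "z = t' \<otimes> k'" by blast
    have "x = (\<alpha> ^^ (n + m)) z" unfolding y(2) z(2)[symmetric] by (simp add: iter_add add.commute)
    also have "\<dots> = (\<alpha> ^^ n) ((\<alpha> ^^ m) t') \<otimes> (\<alpha> ^^ (n + m)) k'"
      using t' K.subset by (auto simp: minus_iff iter_add)
    finally show ?thesis
      using iter_minus[OF t'(1)] iter_Hcl[OF assms(1) t'(2)] unfolding set_mult_def by blast
  qed
  have mono: "(\<alpha> ^^ Suc n) ` Minus V \<subseteq> (\<alpha> ^^ n) ` Minus V" for n
    using iter_minus[of _ V 1] by (auto simp: funpow_swap1)
  have "x \<in> (\<Inter>n. (\<alpha> ^^ n) ` Minus V) <#> Hcl V"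
    using Inter_set_mult_nested[of "\<lambda>n. (\<alpha> ^^ n) ` Minus V" "Hcl V"] in_n mono
      Hcl_compact[OF assms(1)] image_compactin[OF minus_compact[OF assms(1)] iter_continuous]
    by blast
  moreover have "(\<Inter>n. (\<alpha> ^^ n) ` Minus V) \<subseteq> Hcl V"
  proof -
    have "(\<alpha> ^^ n) ` Minus V \<subseteq> Pos V n" for n
    proof (induction n)
      case (Suc n)
      have "(\<alpha> ^^ Suc n) ` Minus V \<subseteq> \<alpha> ` Pos V n" using Suc by auto
      moreover have "(\<alpha> ^^ Suc n) ` Minus V \<subseteq> V"
        using iter_minus[of _ V "Suc n"] minus_subset by blast
      ultimately show ?case by simp
    qed (use minus_subset in simp)
    then have "(\<Inter>n. (\<alpha> ^^ n) ` Minus V) \<subseteq> Plus V" unfolding V_plus_def by blast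
    moreover have "(\<Inter>n. (\<alpha> ^^ n) ` Minus V) \<subseteq> MinusMinus V"
      using INT_lower[of 0 UNIV "\<lambda>n. (\<alpha> ^^ n) ` Minus V"]
      by (intro subset_trans[OF _ minus_subset_minus_minus]) simp
    ultimately have "(\<Inter>n. (\<alpha> ^^ n) ` Minus V) \<subseteq> Plus V \<inter> MinusMinus V"
      by (rule Int_greatest)
    also note plus_Int_minus_minus_subset_homoclinic
    also note homoclinic_subset_Hcl[OF assms(1)]
    finally show ?thesis .
  qed
  ultimately obtain a k where "a \<in> Hcl V" "k \<in> Hcl V" "x = a \<otimes> k"
    unfolding set_mult_def by blast
  then show "x \<in> Hcl V" by simp
qed

section \<open>Making room for the homoclinic closure\<close>

text \<open>The conjugates of \<open>V\<close> by elements of \<open>K\<close> are finite in number, as \<open>K\<close> meets finitely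
  many cosets of \<open>V\<close>. Their intersection \<open>N\<close> is therefore open; it is normalized by \<open>K\<close>, which makes
  \<open>N <#> K\<close> a group.\<close>
lemma ex_open_subgroup_around_compact_subgroup:
  assumes "cosub V" "subgroup K G" "compactin T K"
  obtains W where "cosub W" "K \<subseteq> W" "W \<subseteq> V <#> K"
proof -
  note V = cosubD[OF assms(1)]
  interpret V: subgroup V G by (fact V(1))
  interpret K: subgroup K G by fact
  define N where "N = {g \<in> carrier G. \<forall>l\<in>K. inv l \<otimes> g \<otimes> l \<in> V}"
  have NI: "g \<in> N" if "g \<in> carrier G" "\<And>l. l \<in> K \<Longrightarrow> inv l \<otimes> g \<otimes> l \<in> V" for g
    using that by (simp add: N_def)
  have NV: "inv l \<otimes> g \<otimes> l \<in> V" if "g \<in> N" "l \<in> K" for g l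
    using that by (simp add: N_def)
  have Nc: "g \<in> carrier G" if "g \<in> N" for g using that by (simp add: N_def)
  have "N \<subseteq> V"
  proof
    fix g assume g: "g \<in> N"
    then show "g \<in> V" using NV[OF g K.one_closed] Nc[OF g] by simp
  qed
  have Nsub: "subgroup N G"
  proof (rule subgroupI)
    show "N \<subseteq> carrier G" using Nc by blast
    have "\<one> \<in> N" by (rule NI) auto
    then show "N \<noteq> {}" by blast
    fix a assume a: "a \<in> N"
    show "inv a \<in> N"
    proof (rule NI)
      fix l assume l: "l \<in> K"
      have "inv l \<otimes> inv a \<otimes> l = inv (inv l \<otimes> a \<otimes> l)"
        using Nc[OF a] l by (simp add: inv_mult_group m_assoc)
      then show "inv l \<otimes> inv a \<otimes> l \<in> V" using NV[OF a l] by simp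
    qed (use Nc[OF a] in simp)
    fix b assume b: "b \<in> N"
    show "a \<otimes> b \<in> N"
    proof (rule NI)
      fix l assume l: "l \<in> K"
      have "inv l \<otimes> (a \<otimes> b) \<otimes> l = (inv l \<otimes> a \<otimes> l) \<otimes> (inv l \<otimes> b \<otimes> l)"
        using Nc[OF a] Nc[OF b] l by (simp add: m_assoc)
      then show "inv l \<otimes> (a \<otimes> b) \<otimes> l \<in> V" using NV[OF a l] NV[OF b l] by simp
    qed (use Nc[OF a] Nc[OF b] in simp)
  qed
  have conj: "l \<otimes> g \<otimes> inv l \<in> N" if g: "g \<in> N" and l: "l \<in> K" for g l
  proof (rule NI)
    fix k assume k: "k \<in> K"
    have "inv k \<otimes> (l \<otimes> g \<otimes> inv l) \<otimes> k = inv (inv l \<otimes> k) \<otimes> g \<otimes> (inv l \<otimes> k)"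
      using Nc[OF g] l k by (simp add: inv_mult_group m_assoc)
    then show "inv k \<otimes> (l \<otimes> g \<otimes> inv l) \<otimes> k \<in> V" using NV[OF g, of "inv l \<otimes> k"] l k by simp
  qed (use Nc[OF g] l in simp)
  obtain F where F: "finite F" "F \<subseteq> K" "K \<subseteq> F <#> V"
    using finite_coset_cover[OF assms(3) V(1,3)] .
  let ?U = "(\<Inter>f\<in>F. {g \<in> topspace T. inv f \<otimes> g \<otimes> f \<in> V}) \<inter> topspace T"
  have "openin T ?U"
  proof (cases "F = {}")
    case False
    have "openin T {g \<in> topspace T. inv f \<otimes> g \<otimes> f \<in> V}" if "f \<in> F" for f
    proof (rule openin_continuous_map_preimage[OF _ V(3)])
      have "f \<in> carrier G" using that F(2) K.subset by blast
      then show "continuous_map T T (\<lambda>g. inv f \<otimes> g \<otimes> f)"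
        by (intro continuous_map_group_mult) (simp_all add: topspace_eq_carrier)
    qed
    then show ?thesis using F(1) False by (intro openin_Int openin_INT2 openin_topspace)
  qed simp
  moreover have "\<one> \<in> ?U" using F(2) K.subset by (auto simp: topspace_eq_carrier subset_eq)
  moreover have "?U \<subseteq> N"
  proof
    fix g assume g: "g \<in> ?U"
    then have gc: "g \<in> carrier G" by (simp add: topspace_eq_carrier)
    show "g \<in> N"
    proof (rule NI[OF gc])
      fix l assume "l \<in> K"
      then obtain f v where f: "f \<in> F" "v \<in> V" "l = f \<otimes> v" using F(3) by (auto simp: set_mult_def)
      have "f \<in> carrier G" using f(1) F(2) K.subset by blast
      then have "inv l \<otimes> g \<otimes> l = inv v \<otimes> (inv f \<otimes> g \<otimes> f) \<otimes> v"
        using f(2,3) gc by (simp add: inv_mult_group m_assoc)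
      moreover have "inv f \<otimes> g \<otimes> f \<in> V" using g f(1) by blast
      ultimately show "inv l \<otimes> g \<otimes> l \<in> V" using f(2) by simp
    qed
  qed
  ultimately have Nopen: "openin T N" using subgroup_open_if_contains_open[OF Nsub] by blast
  have Ncomp: "compactin T N"
    using closed_compactin[OF V(2) \<open>N \<subseteq> V\<close> open_subgroup_closed[OF Nsub Nopen]] .
  let ?W = "N <#> K"
  interpret N: subgroup N G by (fact Nsub)
  have Wsub: "subgroup ?W G"
  proof (rule subgroupI)
    show "?W \<subseteq> carrier G" by (rule set_mult_closed[OF N.subset K.subset])
    show "?W \<noteq> {}" using N.one_closed K.one_closed unfolding set_mult_def by blast
    fix x assume "x \<in> ?W"
    then obtain g k where x: "g \<in> N" "k \<in> K" "x = g \<otimes> k" by (auto simp: set_mult_def)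
    have "inv x = (inv k \<otimes> inv g \<otimes> inv (inv k)) \<otimes> inv k"
      using x by (simp add: inv_mult_group m_assoc)
    then show "inv x \<in> ?W" using conj[of "inv g" "inv k"] x unfolding set_mult_def by blast
    fix y assume "y \<in> ?W"
    then obtain h l where y: "h \<in> N" "l \<in> K" "y = h \<otimes> l" by (auto simp: set_mult_def)
    have "x \<otimes> y = (g \<otimes> (k \<otimes> h \<otimes> inv k)) \<otimes> (k \<otimes> l)"
      using x y by (simp add: m_assoc)
    moreover have "g \<otimes> (k \<otimes> h \<otimes> inv k) \<in> N" "k \<otimes> l \<in> K" using x y conj by auto
    ultimately show "x \<otimes> y \<in> ?W" unfolding set_mult_def by blast
  qed
  have inN: "N \<subseteq> ?W"
  proof
    fix g assume g: "g \<in> N"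
    then have "g = g \<otimes> \<one>" by simp
    with g K.one_closed show "g \<in> ?W" unfolding set_mult_def by blast
  qed
  have inK: "K \<subseteq> ?W"
  proof
    fix k assume k: "k \<in> K"
    then have "k = \<one> \<otimes> k" by simp
    with k N.one_closed show "k \<in> ?W" unfolding set_mult_def by blast
  qed
  have "openin T ?W"
    using subgroup_open_if_contains_open[OF Wsub Nopen N.one_closed inN] .
  then have "cosub ?W"
    using Wsub compactin_set_mult[OF Ncomp assms(3)] by (simp add: compact_open_subgroup_def)
  moreover have "?W \<subseteq> V <#> K" using \<open>N \<subseteq> V\<close> by (simp add: mono_set_mult)
  ultimately show thesis using that inK by blast
qed

section \<open>Tidiness below\<close>

text \<open>An element of \<open>V\<close> that ends up in \<open>V\<close> for good is a product of an element of
  \<open>Plus V\<close> that does so, hence a homoclinic one, and an element of \<open>Minus V\<close>. If homoclinic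
  elements never leave \<open>V\<close>, then \<open>MinusMinus V \<inter> V\<close> is just \<open>Minus V\<close>, which is compact, and a
  subgroup that is closed near the identity is closed.\<close>
lemma tidy_below_if_homoclinic_subset:
  assumes "cosub V" "tidy_above G \<alpha> V" "homoclinic V \<subseteq> V"
  shows "tidy_below G T \<alpha> V"
proof -
  note V = cosubD[OF assms(1)]
  interpret M: subgroup "MinusMinus V" G by (rule minus_minus_subgroup[OF V(1)])
  have PM: "Plus V <#> Minus V = V" using assms(2) by (simp only: tidy_above_def)
  have "MinusMinus V \<inter> V = Minus V"
  proof
    show "MinusMinus V \<inter> V \<subseteq> Minus V"
    proof
      fix x assume x: "x \<in> MinusMinus V \<inter> V"
      then have "x \<in> Plus V <#> Minus V" by (simp add: PM)
      then obtain p q where p: "p \<in> Plus V" "q \<in> Minus V" "x = p \<otimes> q"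
        by (auto simp: set_mult_def)
      have c: "p \<in> carrier G" "q \<in> carrier G"
        using p plus_subset V(5) by (auto simp: minus_iff)
      have "q \<in> MinusMinus V" using p(2) minus_subset_minus_minus by blast
      then have "x \<otimes> inv q \<in> MinusMinus V" using x by simp
      then have "p \<in> MinusMinus V" using p(3) c by (simp add: m_assoc)
      then have "p \<in> homoclinic V" using p(1) plus_Int_minus_minus_subset_homoclinic by blast
      then have "(\<alpha> ^^ k) p \<in> homoclinic V" for k
        by (induction k) (use image_homoclinic[OF assms(1)] in auto)
      then have "p \<in> Minus V" using c assms(3) by (auto simp: minus_iff)
      then show "x \<in> Minus V"
        using p subgroup.m_closed[OF minus_subgroup[OF V(1)]] by simp
    qed
    show "Minus V \<subseteq> MinusMinus V \<inter> V" using minus_subset minus_subset_minus_minus by blast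
  qed
  then have "closedin T (MinusMinus V \<inter> V)"
    using minus_compact[OF assms(1)] compactin_imp_closedin[OF Hausdorff] by simp
  then show ?thesis
    unfolding tidy_below_def
    by (rule subgroup_closed_if_locally_closed[OF M.subgroup_axioms V(1,3)])
qed

text \<open>Passing from \<open>W\<close> to \<open>Neg W n\<close> restores tidiness above and keeps \<open>Hcl V\<close> inside, because
  \<open>\<alpha>\<close> maps \<open>Hcl V\<close> into itself; it cannot create homoclinic elements, because it shrinks the group.\<close>
theorem ex_tidy: "\<exists>V. cosub V \<and> tidy G T \<alpha> V"
proof -
  obtain V0 where "cosub V0" using van_Dantzig .
  then obtain i where i: "tidy_above G \<alpha> (Neg V0 i)" using neg_tidy_above by blast
  define V where "V = Neg V0 i"
  have V: "cosub V" "tidy_above G \<alpha> V" using neg_compact_open[OF \<open>cosub V0\<close>] i by (auto simp: V_def)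
  obtain W where W: "cosub W" "Hcl V \<subseteq> W" "W \<subseteq> V <#> Hcl V"
    using ex_open_subgroup_around_compact_subgroup[OF V(1) Hcl_subgroup[OF V(1)] Hcl_compact[OF V(1)]] .
  obtain n where n: "tidy_above G \<alpha> (Neg W n)" using neg_tidy_above[OF W(1)] .
  have cN: "cosub (Neg W n)" by (rule neg_compact_open[OF W(1)])
  have "homoclinic (Neg W n) \<subseteq> homoclinic W" by (rule homoclinic_mono[OF cN neg_subset])
  also have "\<dots> \<subseteq> Hcl V" by (rule homoclinic_subset_Hcl_if_subset[OF V W(1,3)])
  also have "\<dots> \<subseteq> Neg W n"
  proof
    fix k assume k: "k \<in> Hcl V"
    then have "k \<in> carrier G" using W(2) cosubD(5)[OF W(1)] by blast
    with k show "k \<in> Neg W n" using iter_Hcl[OF V(1)] W(2) by (auto simp: neg_iff)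
  qed
  finally have "tidy_below G T \<alpha> (Neg W n)" by (rule tidy_below_if_homoclinic_subset[OF cN n])
  with n cN show ?thesis unfolding tidy_def by blast
qed

end

theorem theorem4p13:
  fixes G :: "('a, 'b) monoid_scheme" and T :: "'a topology" and \<alpha> :: "'a \<Rightarrow> 'a"
  assumes "tdlc_group G T"
    and "\<alpha> \<in> continuous_End G T"
  shows "\<exists>V. compact_open_subgroup V G T \<and> tidy G T \<alpha> V"
proof -
  interpret tdlc_group G T by fact
  interpret tdlc_endo G T \<alpha> by unfold_locales fact
  show ?thesis by (rule ex_tidy)
qed

end
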